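(* Let $n\ge 3$ and let $C_n$ be the cycle graph with vertices $1,\dots,n$ and edges $\{i,i+1\}$ for $1\le i\le n-1$ together with $\{n,1\}$. For small $t>0$ define the edge-length function $l_t$ by $l_t(\{i,i+1\})=t$ for $1\le i\le n-2$, $l_t(\{n-1,n\})=1$, and $l_t(\{n,1\})=t$ (so the vertex weights are $m_0(i)=2t$ for $1\le i\le n-2$ and $m_0(n-1)=m_0(n)=1+t$). Let $0=\lambda_0<\lambda_1(C_n,l_t)\le\lambda_2(C_n,l_t)\le\dots\le\lambda_{n-1}(C_n,l_t)$ be the eigenvalues of the Fujiwara Laplacian $\Delta_{l_t}$, counted with multiplicity. Then as $t\to 0^+$, $\lambda_1(C_n,l_t)$ is of exact order $t^{-1}$ and $\lambda_k(C_n,l_t)$ is of exact order $t^{-2}$ for every $2\le k\le n-1$ (i.e. there are constants $0<c<C$ with $c\,t^{-1}\le\lambda_1\le C\,t^{-1}$ and $c\,t^{-2}\le\lambda_k\le C\,t^{-2}$ for all sufficiently small $t>0$). In particular $\Lambda_1(C_n)=\infty$.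
   Context: For a finite connected simple graph $G=(V,E)$ and an edge-length function $l\colon E\to\mathbb{R}_{>0}$, define $m_0(u)=\sum_{v\sim u} l(uv)$ and $m_1(uv)=1/l(uv)$. The Fujiwara Laplacian is $(\Delta_l\varphi)(u)=\sum_{v\sim u}\frac{m_1(uv)}{m_0(u)}(\varphi(u)-\varphi(v))$ for $\varphi\colon V\to\mathbb{R}$; it is self-adjoint and nonnegative for the inner product $\langle\varphi_1,\varphi_2\rangle=\sum_u m_0(u)\varphi_1(u)\varphi_2(u)$, with kernel the constants; $\lambda_1(G,l)$ is its smallest positive eigenvalue. $\Lambda_1(G)=\sup_l\lambda_1(G,l)$ over all $l$ with $\sum_u m_0(u)=2\sum_{uv\in E}l(uv)=1$; equivalently $\Lambda_1(G)=\sup_l \lambda_1(G,l)\bigl(\sum_u m_0(u)\bigr)^2$ over all unnormalized $l$. *)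

theory Defs
  imports Complex_Main "HOL-Library.Function_Algebras" "HOL-Library.Multiset" "HOL-Library.Extended_Real"
begin

text \<open>A graph is given by its vertex set \<open>V\<close> and its set \<open>E\<close> of two-element edges.\<close>

definition fin_conn_simple_graph :: "'v set \<Rightarrow> 'v set set \<Rightarrow> bool" where
  "fin_conn_simple_graph V E \<longleftrightarrow>
     finite V \<and> V \<noteq> {} \<and> (\<forall>e\<in>E. e \<subseteq> V \<and> card e = 2) \<and>
     (\<forall>u\<in>V. \<forall>v\<in>V. (u, v) \<in> {(x, y). {x, y} \<in> E}\<^sup>*)"

definition neighbours :: "'v set \<Rightarrow> 'v set set \<Rightarrow> 'v \<Rightarrow> 'v set" where
  "neighbours V E u = {v \<in> V. {u, v} \<in> E}"

definition m0 :: "'v set \<Rightarrow> 'v set set \<Rightarrow> ('v set \<Rightarrow> real) \<Rightarrow> 'v \<Rightarrow> real" where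
  "m0 V E l u = (\<Sum>v\<in>neighbours V E u. l {u, v})"

definition m1 :: "('v set \<Rightarrow> real) \<Rightarrow> 'v set \<Rightarrow> real" where
  "m1 l e = 1 / l e"

definition fujiwara_laplacian ::
  "'v set \<Rightarrow> 'v set set \<Rightarrow> ('v set \<Rightarrow> real) \<Rightarrow> ('v \<Rightarrow> real) \<Rightarrow> 'v \<Rightarrow> real" where
  "fujiwara_laplacian V E l \<phi> u =
     (\<Sum>v\<in>neighbours V E u. m1 l {u, v} / m0 V E l u * (\<phi> u - \<phi> v))"

text \<open>The space of functions \<open>V \<rightarrow> \<real>\<close> is represented by the functions vanishing outside \<open>V\<close>.\<close>

definition eigenspace :: "'v set \<Rightarrow> 'v set set \<Rightarrow> ('v set \<Rightarrow> real) \<Rightarrow> real \<Rightarrow> ('v \<Rightarrow> real) set" where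
  "eigenspace V E l \<mu> =
     {\<phi>. (\<forall>u. u \<notin> V \<longrightarrow> \<phi> u = 0) \<and> (\<forall>u\<in>V. fujiwara_laplacian V E l \<phi> u = \<mu> * \<phi> u)}"

definition eigenvalues :: "'v set \<Rightarrow> 'v set set \<Rightarrow> ('v set \<Rightarrow> real) \<Rightarrow> real set" where
  "eigenvalues V E l = {\<mu>. \<exists>\<phi>\<in>eigenspace V E l \<mu>. \<phi> \<noteq> (\<lambda>_. 0)}"

interpretation real_fun: vector_space "\<lambda>(c::real) (\<phi>::'v \<Rightarrow> real) u. c * \<phi> u"
  by unfold_locales (auto simp: fun_eq_iff algebra_simps)

text \<open>The increasing list of eigenvalues, each repeated according to the dimension of its eigenspace.\<close>

definition spectrum_list :: "'v set \<Rightarrow> 'v set set \<Rightarrow> ('v set \<Rightarrow> real) \<Rightarrow> real list" where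
  "spectrum_list V E l = sorted_list_of_multiset
     (\<Sum>\<mu>\<in>eigenvalues V E l. replicate_mset (real_fun.dim (eigenspace V E l \<mu>)) \<mu>)"

definition lambda1 :: "'v set \<Rightarrow> 'v set set \<Rightarrow> ('v set \<Rightarrow> real) \<Rightarrow> real" where
  "lambda1 V E l = Min {\<mu> \<in> eigenvalues V E l. 0 < \<mu>}"

definition Lambda1 :: "'v set \<Rightarrow> 'v set set \<Rightarrow> ereal" where
  "Lambda1 V E =
     (SUP l\<in>{l. (\<forall>e\<in>E. 0 < l e) \<and> (\<Sum>u\<in>V. m0 V E l u) = 1}. ereal (lambda1 V E l))"

definition cycle_verts :: "nat \<Rightarrow> nat set" where
  "cycle_verts n = {1..n}"

definition cycle_edges :: "nat \<Rightarrow> nat set set" where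
  "cycle_edges n = {{i, i + 1} | i. 1 \<le> i \<and> i \<le> n - 1} \<union> {{n, 1}}"

definition cycle_length :: "nat \<Rightarrow> real \<Rightarrow> nat set \<Rightarrow> real" where
  "cycle_length n t e = (if e = {n - 1, n} then 1 else t)"

definition cycle_spectrum :: "nat \<Rightarrow> real \<Rightarrow> real list" where
  "cycle_spectrum n t = spectrum_list (cycle_verts n) (cycle_edges n) (cycle_length n t)"

lemma fin_conn_simple_graph_cycle:
  assumes "n \<ge> 3"
  shows "fin_conn_simple_graph (cycle_verts n) (cycle_edges n)"
proof -
  let ?R = "{(x, y). {x, y} \<in> cycle_edges n}"
  have sym: "sym (?R\<^sup>*)"
    by (intro sym_rtrancl) (auto simp: sym_def insert_commute)
  have from1: "(1, k) \<in> ?R\<^sup>*" if "1 \<le> k" "k \<le> n" for k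
    using that
  proof (induction k rule: dec_induct)
    case base
    show ?case by simp
  next
    case (step k)
    have "{k, k + 1} \<in> cycle_edges n"
      using step unfolding cycle_edges_def by (intro UnI1 CollectI exI[of _ k]) auto
    then have "(k, Suc k) \<in> ?R" by simp
    moreover have "(1, k) \<in> ?R\<^sup>*" using step by simp
    ultimately show ?case by (rule rtrancl_into_rtrancl[rotated])
  qed
  have "(u, v) \<in> ?R\<^sup>*" if "u \<in> cycle_verts n" "v \<in> cycle_verts n" for u v
  proof (rule rtrancl_trans)
    show "(u, 1) \<in> ?R\<^sup>*"
      using that by (intro symD[OF sym, OF from1]) (auto simp: cycle_verts_def)
    show "(1, v) \<in> ?R\<^sup>*"
      using that by (intro from1) (auto simp: cycle_verts_def)
  qed
  moreover have "e \<subseteq> cycle_verts n \<and> card e = 2" if "e \<in> cycle_edges n" for e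
    using that assms unfolding cycle_edges_def cycle_verts_def by (auto simp: card_insert_if)
  moreover have "finite (cycle_verts n)" "cycle_verts n \<noteq> {}"
    using assms by (auto simp: cycle_verts_def)
  ultimately show ?thesis
    unfolding fin_conn_simple_graph_def by blast
qed

lemma cycle_edges_iff:
  "{u, v} \<in> cycle_edges n \<longleftrightarrow>
     (1 \<le> u \<and> u \<le> n - 1 \<and> v = u + 1) \<or> (1 \<le> v \<and> v \<le> n - 1 \<and> u = v + 1) \<or>
     (u = n \<and> v = 1) \<or> (u = 1 \<and> v = n)"
  unfolding cycle_edges_def by (auto simp: doubleton_eq_iff)

lemma m0_cycle:
  assumes "n \<ge> 3" "u \<in> cycle_verts n"
  shows "m0 (cycle_verts n) (cycle_edges n) (cycle_length n t) u =
           (if u \<le> n - 2 then 2 * t else 1 + t)"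
proof -
  have nb: "neighbours (cycle_verts n) (cycle_edges n) u =
      {if u = 1 then n else u - 1, if u = n then 1 else u + 1}"
    using assms unfolding neighbours_def cycle_edges_iff by (auto simp: cycle_verts_def)
  have "(if u = 1 then n else u - 1) \<noteq> (if u = n then 1 else u + 1)"
    using assms by auto
  then show ?thesis
    unfolding m0_def nb using assms
    by (auto simp: cycle_length_def cycle_verts_def doubleton_eq_iff)
qed

end

theory Submission
  imports Defs "HOL-Analysis.Function_Topology"
begin

text \<open>Minimising the Rayleigh quotient on the complements of the earlier eigenfunctions yields an
  orthonormal eigenbasis with increasing eigenvalues, which identifies the spectrum with multiplicities.
  On the cycle, the vertex \<open>n\<close> reaches all other vertices through edges of length \<open>t\<close>, so a function of
  energy \<open>E\<close> vanishing at \<open>n\<close> is \<open>O(sqrt(t E))\<close> everywhere. Its squared norm is therefore \<open>O(t E)\<close>, and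
  even \<open>O(t\<^sup>2 E)\<close> if it also vanishes at the other heavy vertex \<open>n - 1\<close>. As these conditions have
  codimension 1 and 2, \<open>\<lambda>\<^sub>1\<close> has order at least \<open>1/t\<close> and \<open>\<lambda>\<^sub>2\<close> order at least \<open>1/t\<^sup>2\<close>. The upper bounds
  come from the indicator function of \<open>n\<close> and from the maximum principle. Rescaling to total
  weight 1 changes \<open>\<lambda>\<^sub>1\<close> by a bounded factor only, whence the supremum is infinite.\<close>

section \<open>Linear algebra and a variational criterion\<close>

text \<open>Gaussian elimination, one equation at a time. All later dimension counts rest on this
  fact: nonzero functions orthogonal to given ones, combinations vanishing on a set, and
  completeness of an orthonormal system.\<close>

lemma underdetermined_system_solvable:
  fixes a :: "'i \<Rightarrow> 'j \<Rightarrow> real"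
  assumes "finite J" "finite I" "card J < card I"
  shows "\<exists>x. (\<exists>i\<in>I. x i \<noteq> 0) \<and> (\<forall>j\<in>J. (\<Sum>i\<in>I. a i j * x i) = 0)"
  using assms
proof (induction J arbitrary: I a rule: finite_induct)
  case empty
  then have "I \<noteq> {}" by auto
  then show ?case by (intro exI[of _ "\<lambda>_. 1"]) auto
next
  case (insert j J)
  show ?case
  proof (cases "\<forall>i\<in>I. a i j = 0")
    case True
    from insert.IH[of I a] insert.prems insert.hyps
    obtain x where "\<exists>i\<in>I. x i \<noteq> 0" "\<forall>j\<in>J. (\<Sum>i\<in>I. a i j * x i) = 0" by auto
    with True show ?thesis by (intro exI[of _ x]) auto
  next
    case False
    then obtain p where p: "p \<in> I" "a p j \<noteq> 0" by auto
    \<comment> \<open>\<open>b\<close> is the system left after the unknown \<open>p\<close> has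
      been eliminated by means of equation \<open>j\<close>, whose pivot is
      \<open>a p j\<close>.\<close>
    define b where "b i k = a i k - a i j / a p j * a p k" for i k
    have "card J < card (I - {p})" using insert p by auto
    with insert.IH[of "I - {p}" b] insert.prems
    obtain x where x: "\<exists>i\<in>I - {p}. x i \<noteq> 0" "\<forall>k\<in>J. (\<Sum>i\<in>I - {p}. b i k * x i) = 0" by auto
    define s where "s = (\<Sum>i\<in>I - {p}. a i j * x i)"
    \<comment> \<open>Back substitution: the value at \<open>p\<close> is the one that makes
      equation \<open>j\<close> hold.\<close>
    define y where "y = x(p := - s / a p j)"
    have split: "(\<Sum>i\<in>I. a i k * y i) = a p k * y p + (\<Sum>i\<in>I - {p}. a i k * x i)" for k
      using p insert.prems by (subst sum.remove[of I p]) (auto simp: y_def intro!: sum.cong)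
    have "(\<Sum>i\<in>I. a i k * y i) = 0" if "k \<in> J" for k
    proof -
      have "0 = (\<Sum>i\<in>I - {p}. a i k * x i - a p k / a p j * (a i j * x i))"
        using x that by (auto simp: b_def algebra_simps)
      also have "\<dots> = (\<Sum>i\<in>I - {p}. a i k * x i) - a p k / a p j * s"
        by (simp add: sum_subtractf sum_distrib_left s_def)
      finally show ?thesis unfolding split by (simp add: y_def)
    qed
    moreover have "(\<Sum>i\<in>I. a i j * y i) = 0"
      unfolding split using p by (simp add: y_def s_def)
    moreover have "\<exists>i\<in>I. y i \<noteq> 0" using x by (auto simp: y_def)
    ultimately show ?thesis by blast
  qed
qed

text \<open>The polynomial has its minimum 0 at \<open>s = 0\<close>, so its derivative
  \<open>2 * b\<close> vanishes there. This is the stationarity condition for minimisers of the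
  Rayleigh quotient.\<close>

lemma linear_coeff_zero_if_quadratic_nonneg:
  fixes b c :: real
  assumes "\<And>s. 0 \<le> 2 * s * b + s\<^sup>2 * c"
  shows "b = 0"
proof (rule ccontr)
  assume "b \<noteq> 0"
  \<comment> \<open>The critical point \<open>- b / c\<close>, with \<open>c\<close> replaced by the
    positive number \<open>\<bar>c\<bar> + 1\<close>. The quadratic term is then at most
    \<open>- s * b\<close>, half the size of the negative linear term.\<close>
  define s where "s = - b / (\<bar>c\<bar> + 1)"
  have "s\<^sup>2 * c \<le> s\<^sup>2 * (\<bar>c\<bar> + 1)" by (intro mult_left_mono) auto
  also have "\<dots> = - s * b"
  proof -
    have "s * (\<bar>c\<bar> + 1) = - b" by (simp add: s_def)
    then show ?thesis by (simp add: power2_eq_square mult.assoc)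
  qed
  finally have "0 \<le> s * b" using assms[of s] by linarith
  then have "b\<^sup>2 \<le> 0" by (simp add: s_def power2_eq_square field_simps)
  with \<open>b \<noteq> 0\<close> show False by simp
qed

lemma sum_fun_apply: "(\<Sum>i\<in>A. f i) x = (\<Sum>i\<in>A. f i x :: real)"
  by (induction A rule: infinite_finite_induct) auto

section \<open>Inner product and Dirichlet energy\<close>

locale weighted_graph =
  fixes V :: "'v set" and E :: "'v set set" and l :: "'v set \<Rightarrow> real"
  assumes finite_V: "finite V"
    and length_pos: "e \<in> E \<Longrightarrow> 0 < l e"
    and weight_pos: "u \<in> V \<Longrightarrow> 0 < m0 V E l u"
begin

abbreviation lap :: "('v \<Rightarrow> real) \<Rightarrow> 'v \<Rightarrow> real" where
  "lap \<equiv> fujiwara_laplacian V E l"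

definition ip :: "('v \<Rightarrow> real) \<Rightarrow> ('v \<Rightarrow> real) \<Rightarrow> real" where
  "ip \<phi> \<psi> = (\<Sum>u\<in>V. m0 V E l u * \<phi> u * \<psi> u)"

text \<open>The Dirichlet form. The double sum meets each edge in both orientations, hence the
  division by 2.\<close>

definition energy :: "('v \<Rightarrow> real) \<Rightarrow> ('v \<Rightarrow> real) \<Rightarrow> real" where
  "energy \<phi> \<psi> = (\<Sum>u\<in>V. \<Sum>v\<in>neighbours V E u. (\<phi> u - \<phi> v) * (\<psi> u - \<psi> v) / l {u, v}) / 2"

lemma finite_neighbours: "finite (neighbours V E u)"
  using finite_V by (auto simp: neighbours_def)

lemma ip_commute: "ip \<phi> \<psi> = ip \<psi> \<phi>"
  by (simp add: ip_def mult.commute mult.left_commute)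

lemma ip_linear_left:
  "ip (\<lambda>u. a * \<phi> u + b * \<psi> u) \<chi> = a * ip \<phi> \<chi> + b * ip \<psi> \<chi>"
  by (simp add: ip_def sum.distrib sum_distrib_left algebra_simps)

lemma ip_linear_right:
  "ip \<chi> (\<lambda>u. a * \<phi> u + b * \<psi> u) = a * ip \<chi> \<phi> + b * ip \<chi> \<psi>"
  using ip_linear_left[of a \<phi> b \<psi> \<chi>] by (simp add: ip_commute)

lemma ip_sum_left: "ip (\<lambda>u. \<Sum>i\<in>I. c i * \<phi> i u) \<psi> = (\<Sum>i\<in>I. c i * ip (\<phi> i) \<psi>)"
proof -
  have "ip (\<lambda>u. \<Sum>i\<in>I. c i * \<phi> i u) \<psi> = (\<Sum>u\<in>V. \<Sum>i\<in>I. c i * (m0 V E l u * \<phi> i u * \<psi> u))"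
    by (simp add: ip_def sum_distrib_left sum_distrib_right mult_ac)
  also have "\<dots> = (\<Sum>i\<in>I. c i * ip (\<phi> i) \<psi>)"
    by (subst sum.swap) (simp add: ip_def sum_distrib_left)
  finally show ?thesis .
qed

lemma ip_cong:
  assumes "\<And>u. u \<in> V \<Longrightarrow> \<phi> u = \<phi>' u" "\<And>u. u \<in> V \<Longrightarrow> \<psi> u = \<psi>' u"
  shows "ip \<phi> \<psi> = ip \<phi>' \<psi>'"
  using assms by (auto simp: ip_def intro!: sum.cong)

lemma energy_cong:
  assumes "\<And>u. u \<in> V \<Longrightarrow> \<phi> u = \<phi>' u" "\<And>u. u \<in> V \<Longrightarrow> \<psi> u = \<psi>' u"
  shows "energy \<phi> \<psi> = energy \<phi>' \<psi>'"
  using assms by (auto simp: energy_def neighbours_def intro!: sum.cong)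

lemma ip_self_nonneg: "0 \<le> ip \<phi> \<phi>"
  unfolding ip_def using weight_pos by (auto intro!: sum_nonneg simp: mult.assoc less_imp_le)

lemma ip_self_eq_0_iff: "ip \<phi> \<phi> = 0 \<longleftrightarrow> (\<forall>u\<in>V. \<phi> u = 0)"
proof -
  have "ip \<phi> \<phi> = 0 \<longleftrightarrow> (\<forall>u\<in>V. m0 V E l u * \<phi> u * \<phi> u = 0)"
    unfolding ip_def using weight_pos finite_V
    by (intro sum_nonneg_eq_0_iff) (auto simp: mult.assoc less_imp_le)
  also have "\<dots> \<longleftrightarrow> (\<forall>u\<in>V. \<phi> u = 0)" using weight_pos by force
  finally show ?thesis .
qed

lemma energy_commute: "energy \<phi> \<psi> = energy \<psi> \<phi>"
  by (simp add: energy_def mult.commute)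

lemma energy_self_nonneg: "0 \<le> energy \<phi> \<phi>"
  unfolding energy_def neighbours_def
  by (auto intro!: sum_nonneg divide_nonneg_nonneg dest!: length_pos)

lemma weight_times_lap:
  assumes "u \<in> V"
  shows "m0 V E l u * lap \<phi> u = (\<Sum>v\<in>neighbours V E u. m1 l {u, v} * (\<phi> u - \<phi> v))"
  using weight_pos[OF assms] by (simp add: fujiwara_laplacian_def sum_distrib_left)

text \<open>Discrete Green formula: the vertex weight cancels the denominator of the Laplacian, and
  exchanging the endpoints of an edge changes the sign of the difference. Symmetry and bilinearity
  pass between the two forms through it.\<close>

lemma energy_eq_ip_lap: "energy \<phi> \<psi> = ip (lap \<phi>) \<psi>"
proof -
  \<comment> \<open>The gradient along an edge is extended by 0 to all pairs, so that both sums
    range over \<open>V\<close> and can be exchanged.\<close>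
  define g where "g u v = (if {u, v} \<in> E then (\<phi> u - \<phi> v) / l {u, v} else 0)" for u v
  have to_V: "(\<Sum>v\<in>neighbours V E u. h v) = (\<Sum>v\<in>V. if {u, v} \<in> E then h v else 0)"
    for u and h :: "'v \<Rightarrow> real"
    unfolding neighbours_def using finite_V by (simp add: sum.inter_filter)
  have anti: "g u v = - g v u" for u v
    by (auto simp: g_def insert_commute minus_divide_left)
  have "ip (lap \<phi>) \<psi> = (\<Sum>u\<in>V. \<Sum>v\<in>V. g u v * \<psi> u)"
    unfolding ip_def
  proof (rule sum.cong[OF refl])
    fix u assume "u \<in> V"
    then have "m0 V E l u * lap \<phi> u = (\<Sum>v\<in>neighbours V E u. (\<phi> u - \<phi> v) / l {u, v})"
      by (simp add: weight_times_lap m1_def)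
    also have "\<dots> = (\<Sum>v\<in>V. g u v)" by (simp add: to_V g_def)
    finally show "m0 V E l u * lap \<phi> u * \<psi> u = (\<Sum>v\<in>V. g u v * \<psi> u)"
      by (simp add: sum_distrib_right)
  qed
  moreover have "(\<Sum>u\<in>V. \<Sum>v\<in>V. g u v * \<psi> v) = - (\<Sum>u\<in>V. \<Sum>v\<in>V. g u v * \<psi> u)"
    by (subst sum.swap, subst anti) (simp add: sum_negf)
  moreover have "energy \<phi> \<psi> = (\<Sum>u\<in>V. \<Sum>v\<in>V. g u v * \<psi> u - g u v * \<psi> v) / 2"
    unfolding energy_def to_V
    by (intro arg_cong2[where f = "(/)"] sum.cong refl) (auto simp: g_def ring_distribs diff_divide_distrib)
  ultimately show ?thesis by (simp add: sum_subtractf)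
qed

lemma energy_linear_right:
  "energy \<chi> (\<lambda>u. a * \<phi> u + b * \<psi> u) = a * energy \<chi> \<phi> + b * energy \<chi> \<psi>"
  by (simp add: energy_eq_ip_lap ip_linear_right)

lemma energy_linear_left:
  "energy (\<lambda>u. a * \<phi> u + b * \<psi> u) \<chi> = a * energy \<phi> \<chi> + b * energy \<psi> \<chi>"
  using energy_linear_right[of \<chi> a \<phi> b \<psi>] by (simp add: energy_commute)

lemma energy_shift: "energy (\<lambda>u. a + \<phi> u) (\<lambda>u. a + \<phi> u) = energy \<phi> \<phi>"
  by (simp add: energy_def)

text \<open>All terms of the energy are nonnegative, and the term of this edge occurs in the row of
  \<open>u\<close> and in the row of \<open>v\<close>, which compensates the factor 1/2.\<close>

lemma edge_difference_le_energy:
  assumes "u \<in> V" "v \<in> V" "u \<noteq> v" "{u, v} \<in> E"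
  shows "(\<phi> u - \<phi> v)\<^sup>2 \<le> l {u, v} * energy \<phi> \<phi>"
proof -
  define g where "g x y = (\<phi> x - \<phi> y) * (\<phi> x - \<phi> y) / l {x, y}" for x y
  define G where "G x = (\<Sum>y\<in>neighbours V E x. g x y)" for x
  have g_nonneg: "0 \<le> g x y" if "y \<in> neighbours V E x" for x y
    using that length_pos[of "{x, y}"] by (auto simp: g_def neighbours_def)
  have "g x y \<le> G x" if "y \<in> neighbours V E x" for x y
    unfolding G_def using g_nonneg finite_neighbours that by (intro member_le_sum) auto
  moreover have "v \<in> neighbours V E u" "u \<in> neighbours V E v"
    using assms by (auto simp: neighbours_def insert_commute)
  ultimately have "g u v + g v u \<le> G u + G v" by (intro add_mono)
  also have "\<dots> = (\<Sum>x\<in>{u, v}. G x)" using assms by simp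
  also have "\<dots> \<le> (\<Sum>x\<in>V. G x)"
    using assms finite_V g_nonneg by (intro sum_mono2) (auto simp: G_def intro!: sum_nonneg)
  also have "\<dots> = 2 * energy \<phi> \<phi>" by (simp add: energy_def G_def g_def)
  also have "g u v + g v u = 2 * g u v"
    by (simp add: g_def insert_commute) (simp add: algebra_simps)
  finally have "g u v \<le> energy \<phi> \<phi>" by simp
  then show ?thesis
    using length_pos[OF assms(4)] by (simp add: g_def power2_eq_square field_simps)
qed

section \<open>Continuity and compactness in the product topology\<close>

lemma continuous_on_ip: "continuous_on S (\<lambda>\<phi>. ip \<psi> \<phi>)" "continuous_on S (\<lambda>\<phi>. ip \<phi> \<phi>)"
  unfolding ip_def
  by (intro continuous_intros continuous_on_subset[OF continuous_on_product_coordinates]; simp)+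

lemma continuous_on_energy: "continuous_on S (\<lambda>\<phi>. energy \<phi> \<phi>)"
proof -
  have "continuous_on S (\<lambda>\<phi>. \<phi> u)" for u :: 'v and S :: "('v \<Rightarrow> real) set"
    using continuous_on_subset[OF continuous_on_product_coordinates] by auto
  \<comment> \<open>Division is written as multiplication by a constant, so that no nonvanishing
    condition arises for pairs that are not edges.\<close>
  then have "continuous_on S (\<lambda>\<phi>. (\<phi> u - \<phi> v) * (\<phi> u - \<phi> v) * (1 / l {u, v}))" for u v
    by (intro continuous_intros)
  then have "continuous_on S (\<lambda>\<phi>. (\<Sum>u\<in>V. \<Sum>v\<in>neighbours V E u.
      (\<phi> u - \<phi> v) * (\<phi> u - \<phi> v) * (1 / l {u, v})) * (1/2))"
    by (intro continuous_on_mult_right[of _ _ "1/2"] continuous_on_sum)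
  then show ?thesis by (simp add: energy_def)
qed

text \<open>The sphere is a closed subset of a product of compact intervals. Vanishing outside
  \<open>V\<close> makes this work when the type \<open>'v\<close> is infinite: the intervals there
  are reduced to 0.\<close>

lemma compact_unit_sphere: "compact {\<phi>. (\<forall>u. u \<notin> V \<longrightarrow> \<phi> u = 0) \<and> ip \<phi> \<phi> = 1}"
proof -
  \<comment> \<open>The norm condition gives \<open>(\<phi> u)\<^sup>2 \<le> 1 / m0 V E l u\<close>.
    Since \<open>x \<le> (x + 1)\<^sup>2\<close> for \<open>x \<ge> 0\<close>, the bound avoids a
    square root.\<close>
  define B where "B u = (if u \<in> V then 1 / m0 V E l u + 1 else 0)" for u
  have "compactin (product_topology (\<lambda>i. euclidean) UNIV) (PiE UNIV (\<lambda>u. {- B u..B u}))"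
    unfolding compactin_PiE by simp
  then have comp: "compact (PiE UNIV (\<lambda>u. {- B u..B u}))"
    by (simp add: euclidean_product_topology)
  have sub: "{\<phi>. (\<forall>u. u \<notin> V \<longrightarrow> \<phi> u = 0) \<and> ip \<phi> \<phi> = 1} \<subseteq> PiE UNIV (\<lambda>u. {- B u..B u})"
  proof (intro subsetI PiE_I)
    fix \<phi> u assume "\<phi> \<in> {\<phi>. (\<forall>u. u \<notin> V \<longrightarrow> \<phi> u = 0) \<and> ip \<phi> \<phi> = 1}"
    then have \<phi>: "u \<notin> V \<Longrightarrow> \<phi> u = 0" "ip \<phi> \<phi> = 1" by auto
    show "\<phi> u \<in> {- B u..B u}"
    proof (cases "u \<in> V")
      case True
      have "m0 V E l u * \<phi> u * \<phi> u \<le> ip \<phi> \<phi>"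
        unfolding ip_def using True finite_V weight_pos
        by (intro member_le_sum) (auto simp: mult.assoc less_imp_le)
      then have "(\<phi> u)\<^sup>2 \<le> 1 / m0 V E l u"
        using \<phi> weight_pos[OF True] by (simp add: power2_eq_square field_simps)
      also have "\<dots> \<le> (1 / m0 V E l u + 1)\<^sup>2"
        using weight_pos[OF True] zero_le_power2[of "1 / m0 V E l u"]
        unfolding power2_sum by (simp add: add_increasing add_increasing2 divide_right_mono)
      finally have "\<bar>\<phi> u\<bar>\<^sup>2 \<le> (1 / m0 V E l u + 1)\<^sup>2" by simp
      then have "\<bar>\<phi> u\<bar> \<le> 1 / m0 V E l u + 1"
        by (rule power2_le_imp_le) (use weight_pos[OF True] in simp)
      then show ?thesis using True by (simp add: B_def abs_le_iff)
    qed (use \<phi> in \<open>simp add: B_def\<close>)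
  qed auto
  have eq: "{\<phi>. (\<forall>u. u \<notin> V \<longrightarrow> \<phi> u = 0) \<and> ip \<phi> \<phi> = 1} =
      (\<Inter>u\<in>-V. {\<phi>. \<phi> u = 0}) \<inter> {\<phi>. ip \<phi> \<phi> = 1}" by auto
  have "closed {\<phi>. (\<forall>u. u \<notin> V \<longrightarrow> \<phi> u = 0) \<and> ip \<phi> \<phi> = 1}"
    unfolding eq using continuous_on_ip
    by (intro closed_Int closed_INT ballI closed_Collect_eq continuous_on_const) auto
  from compact_Int_closed[OF comp this] sub show ?thesis by (simp only: Int_absorb1)
qed

section \<open>A Gershgorin-type upper bound\<close>

text \<open>The diagonal coefficients of the Laplacian are at most \<open>a\<close>, and the other
  coefficients of a row have the same total absolute value; hence the factor 2.\<close>

lemma eigenvalue_le: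
  assumes "\<nu> \<in> eigenvalues V E l" "0 \<le> \<nu>"
    and bound: "\<And>u. u \<in> V \<Longrightarrow> (\<Sum>v\<in>neighbours V E u. m1 l {u, v}) \<le> a * m0 V E l u"
  shows "\<nu> \<le> 2 * a"
proof -
  obtain \<phi> where \<phi>: "\<phi> \<in> eigenspace V E l \<nu>" "\<phi> \<noteq> (\<lambda>_. 0)"
    using assms by (auto simp: eigenvalues_def)
  then obtain w where w: "w \<in> V" "\<phi> w \<noteq> 0" by (auto simp: eigenspace_def fun_eq_iff)
  \<comment> \<open>The eigenvalue equation is evaluated where \<open>\<bar>\<phi>\<bar>\<close> is maximal.\<close>
  have "Max ((\<lambda>v. \<bar>\<phi> v\<bar>) ` V) \<in> (\<lambda>v. \<bar>\<phi> v\<bar>) ` V"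
    using finite_V w by (intro Max_in) auto
  then obtain u where u: "u \<in> V" "Max ((\<lambda>v. \<bar>\<phi> v\<bar>) ` V) = \<bar>\<phi> u\<bar>" by auto
  have max: "\<bar>\<phi> v\<bar> \<le> \<bar>\<phi> u\<bar>" if "v \<in> V" for v
    using Max_ge[of "(\<lambda>v. \<bar>\<phi> v\<bar>) ` V" "\<bar>\<phi> v\<bar>"] finite_V that u(2) by auto
  have m: "0 < m0 V E l u" using weight_pos u by simp
  have "m0 V E l u * (\<nu> * \<phi> u) = m0 V E l u * lap \<phi> u"
    using \<phi> u by (simp add: eigenspace_def)
  also have "\<dots> = (\<Sum>v\<in>neighbours V E u. m1 l {u, v} * (\<phi> u - \<phi> v))"
    by (rule weight_times_lap[OF u(1)])
  finally have eq: "m0 V E l u * (\<nu> * \<phi> u) = (\<Sum>v\<in>neighbours V E u. m1 l {u, v} * (\<phi> u - \<phi> v))" .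
  have "m0 V E l u * \<nu> * \<bar>\<phi> u\<bar> = \<bar>\<Sum>v\<in>neighbours V E u. m1 l {u, v} * (\<phi> u - \<phi> v)\<bar>"
    using m assms(2) by (simp add: abs_mult flip: eq)
  also have "\<dots> \<le> (\<Sum>v\<in>neighbours V E u. m1 l {u, v} * (2 * \<bar>\<phi> u\<bar>))"
  proof (rule order_trans[OF sum_abs sum_mono])
    fix v assume "v \<in> neighbours V E u"
    then have "v \<in> V" "0 < m1 l {u, v}"
      using length_pos by (auto simp: neighbours_def m1_def)
    then show "\<bar>m1 l {u, v} * (\<phi> u - \<phi> v)\<bar> \<le> m1 l {u, v} * (2 * \<bar>\<phi> u\<bar>)"
      using max[of v] by (auto simp: abs_mult)
  qed
  also have "\<dots> = (\<Sum>v\<in>neighbours V E u. m1 l {u, v}) * (2 * \<bar>\<phi> u\<bar>)"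
    by (simp add: sum_distrib_right)
  also have "\<dots> \<le> a * m0 V E l u * (2 * \<bar>\<phi> u\<bar>)"
    using u by (intro mult_right_mono bound) auto
  finally have "\<nu> * (m0 V E l u * \<bar>\<phi> u\<bar>) \<le> 2 * a * (m0 V E l u * \<bar>\<phi> u\<bar>)"
    by (simp add: mult_ac)
  moreover have "0 < \<bar>\<phi> u\<bar>" using max[OF w(1)] w(2) by linarith
  ultimately show ?thesis using m by simp
qed

section \<open>Orthonormal eigenfunctions by Rayleigh minimisation\<close>

text \<open>The last clause makes \<open>\<mu> i\<close> the minimum of the Rayleigh quotient on the
  complement of the earlier functions. It admits test functions of arbitrary support, because
  \<open>ip\<close> and \<open>energy\<close> see only values on \<open>V\<close>.\<close>

definition eigensystem :: "nat \<Rightarrow> (nat \<Rightarrow> 'v \<Rightarrow> real) \<Rightarrow> (nat \<Rightarrow> real) \<Rightarrow> bool" where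
  "eigensystem k e \<mu> \<longleftrightarrow>
     (\<forall>i<k. e i \<in> eigenspace V E l (\<mu> i)) \<and>
     (\<forall>i<k. \<forall>j<k. ip (e i) (e j) = (if i = j then 1 else 0)) \<and>
     (\<forall>i<k. \<forall>\<phi>. (\<forall>j<i. ip (e j) \<phi> = 0) \<longrightarrow> \<mu> i * ip \<phi> \<phi> \<le> energy \<phi> \<phi>)"

lemma energy_eigenfunction:
  assumes "\<phi> \<in> eigenspace V E l \<mu>"
  shows "energy \<phi> \<psi> = \<mu> * ip \<phi> \<psi>"
proof -
  have "energy \<phi> \<psi> = ip (\<lambda>u. \<mu> * \<phi> u + 0 * \<phi> u) \<psi>"
    unfolding energy_eq_ip_lap using assms by (intro ip_cong) (auto simp: eigenspace_def)
  then show ?thesis unfolding ip_linear_left by simp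
qed

text \<open>The energy attains its minimum on the compact set of admissible unit functions, and
  homogeneity carries the bound over to all admissible functions.\<close>

lemma rayleigh_minimiser_exists:
  fixes e :: "nat \<Rightarrow> 'v \<Rightarrow> real"
  assumes "k < card V"
  obtains \<phi> where "\<And>u. u \<notin> V \<Longrightarrow> \<phi> u = 0" "ip \<phi> \<phi> = 1" "\<And>j. j < k \<Longrightarrow> ip (e j) \<phi> = 0"
    "\<And>\<psi>. (\<And>j. j < k \<Longrightarrow> ip (e j) \<psi> = 0) \<Longrightarrow> energy \<phi> \<phi> * ip \<psi> \<psi> \<le> energy \<psi> \<psi>"
proof -
  define K where "K = {\<phi>. (\<forall>u. u \<notin> V \<longrightarrow> \<phi> u = 0) \<and> ip \<phi> \<phi> = 1} \<inter> (\<Inter>j<k. {\<phi>. ip (e j) \<phi> = 0})"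
  define normalise where "normalise \<psi> u = (if u \<in> V then \<psi> u / sqrt (ip \<psi> \<psi>) else 0)" for \<psi> u
  have ip_normalise: "ip \<chi> (normalise \<psi>) = 1 / sqrt (ip \<psi> \<psi>) * ip \<chi> \<psi>" for \<psi> \<chi>
  proof -
    have "ip \<chi> (normalise \<psi>) = ip \<chi> (\<lambda>u. 1 / sqrt (ip \<psi> \<psi>) * \<psi> u + 0 * \<psi> u)"
      by (intro ip_cong) (auto simp: normalise_def)
    then show ?thesis unfolding ip_linear_right by simp
  qed
  have energy_normalise: "energy (normalise \<psi>) (normalise \<psi>) = energy \<psi> \<psi> / ip \<psi> \<psi>" for \<psi>
  proof -
    have "energy (normalise \<psi>) (normalise \<psi>) =
        energy (\<lambda>u. 1 / sqrt (ip \<psi> \<psi>) * \<psi> u + 0 * \<psi> u) (\<lambda>u. 1 / sqrt (ip \<psi> \<psi>) * \<psi> u + 0 * \<psi> u)"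
      by (intro energy_cong) (auto simp: normalise_def)
    also have "\<dots> = energy \<psi> \<psi> / (sqrt (ip \<psi> \<psi>) * sqrt (ip \<psi> \<psi>))"
      unfolding energy_linear_right energy_linear_left by simp
    finally show ?thesis using ip_self_nonneg[of \<psi>] by simp
  qed
  have normalise_K: "normalise \<psi> \<in> K" if "ip \<psi> \<psi> \<noteq> 0" "\<And>j. j < k \<Longrightarrow> ip (e j) \<psi> = 0" for \<psi>
  proof -
    have "ip (normalise \<psi>) (normalise \<psi>) = ip \<psi> \<psi> / (sqrt (ip \<psi> \<psi>) * sqrt (ip \<psi> \<psi>))"
      unfolding ip_normalise ip_commute[of "normalise \<psi>" \<psi>] by simp
    then have "ip (normalise \<psi>) (normalise \<psi>) = 1"
      using that ip_self_nonneg[of \<psi>] by simp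
    then show ?thesis using that by (auto simp: K_def ip_normalise) (auto simp: normalise_def)
  qed
  \<comment> \<open>The minimisation is over a nonempty set: \<open>k\<close> orthogonality
    conditions on \<open>card V\<close> values leave a nonzero solution.\<close>
  obtain x where x: "\<exists>u\<in>V. x u \<noteq> 0" "\<forall>j\<in>{..<k}. (\<Sum>u\<in>V. m0 V E l u * e j u * x u) = 0"
    using underdetermined_system_solvable[of "{..<k}" V "\<lambda>u j. m0 V E l u * e j u"] assms finite_V
    by auto
  then have "ip x x \<noteq> 0" "\<And>j. j < k \<Longrightarrow> ip (e j) x = 0"
    by (auto simp: ip_self_eq_0_iff) (auto simp: ip_def)
  then have "K \<noteq> {}" using normalise_K by blast
  moreover have "compact K"
    unfolding K_def
    by (intro compact_Int_closed compact_unit_sphere closed_INT ballI closed_Collect_eq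
        continuous_on_ip continuous_on_const)
  ultimately obtain \<phi> where \<phi>: "\<phi> \<in> K" "\<And>\<psi>. \<psi> \<in> K \<Longrightarrow> energy \<phi> \<phi> \<le> energy \<psi> \<psi>"
    using continuous_attains_inf[of K "\<lambda>\<phi>. energy \<phi> \<phi>"] continuous_on_energy by blast
  have "energy \<phi> \<phi> * ip \<psi> \<psi> \<le> energy \<psi> \<psi>" if "\<And>j. j < k \<Longrightarrow> ip (e j) \<psi> = 0" for \<psi>
  proof (cases "ip \<psi> \<psi> = 0")
    case True
    then show ?thesis using energy_self_nonneg[of \<psi>] by simp
  next
    case False
    then have "energy \<phi> \<phi> \<le> energy \<psi> \<psi> / ip \<psi> \<psi>"
      using \<phi>(2)[OF normalise_K[OF False that]] energy_normalise by simp
    then show ?thesis using False ip_self_nonneg[of \<psi>] by (simp add: field_simps)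
  qed
  with \<phi> show thesis by (intro that[of \<phi>]) (auto simp: K_def)
qed

text \<open>The next function is the minimiser orthogonal to those already found; stationarity turns
  it into an eigenfunction.\<close>

lemma eigensystem_exists: "k \<le> card V \<Longrightarrow> \<exists>e \<mu>. eigensystem k e \<mu>"
proof (induction k)
  case 0
  show ?case by (simp add: eigensystem_def)
next
  case (Suc k)
  then obtain e \<mu> where sys: "eigensystem k e \<mu>" by auto
  obtain \<phi> where \<phi>: "\<And>u. u \<notin> V \<Longrightarrow> \<phi> u = 0" "ip \<phi> \<phi> = 1" "\<And>j. j < k \<Longrightarrow> ip (e j) \<phi> = 0"
    "\<And>\<psi>. (\<And>j. j < k \<Longrightarrow> ip (e j) \<psi> = 0) \<Longrightarrow> energy \<phi> \<phi> * ip \<psi> \<psi> \<le> energy \<psi> \<psi>"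
    using rayleigh_minimiser_exists[of k e] Suc.prems by (metis Suc_le_lessD)
  define \<nu> where "\<nu> = energy \<phi> \<phi>"
  \<comment> \<open>\<open>\<psi>\<close> is the residual of the eigenvalue equation for
    \<open>\<phi>\<close>. It serves as its own test direction.\<close>
  define \<psi> where "\<psi> u = 1 * lap \<phi> u + (- \<nu>) * \<phi> u" for u
  have \<psi>_eq: "\<psi> = (\<lambda>u. 1 * lap \<phi> u + (- \<nu>) * \<phi> u)" by (auto simp: \<psi>_def)
  have ip_\<psi>: "ip \<chi> \<psi> = energy \<phi> \<chi> - \<nu> * ip \<chi> \<phi>" for \<chi>
    unfolding \<psi>_eq ip_linear_right by (simp add: energy_eq_ip_lap ip_commute)
  \<comment> \<open>By symmetry of the Laplacian the residual stays orthogonal to the earlier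
    eigenfunctions, so it is an admissible variation.\<close>
  have orth: "ip (e j) \<psi> = 0" if "j < k" for j
  proof -
    have "energy (e j) \<phi> = \<mu> j * ip (e j) \<phi>"
      using sys that by (intro energy_eigenfunction) (auto simp: eigensystem_def)
    then show ?thesis using \<phi>(3)[OF that] by (simp add: ip_\<psi> energy_commute)
  qed
  \<comment> \<open>The first variation of \<open>energy - \<nu> * ip\<close> at
    \<open>\<phi>\<close> in direction \<open>\<psi>\<close>; by \<open>ip_\<psi>\<close> it equals
    the squared norm of \<open>\<psi>\<close>.\<close>
  have "energy \<phi> \<psi> - \<nu> * ip \<phi> \<psi> = 0"
  proof (rule linear_coeff_zero_if_quadratic_nonneg)
    fix s :: real
    have "\<nu> * ip (\<lambda>u. 1 * \<phi> u + s * \<psi> u) (\<lambda>u. 1 * \<phi> u + s * \<psi> u) \<le>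
        energy (\<lambda>u. 1 * \<phi> u + s * \<psi> u) (\<lambda>u. 1 * \<phi> u + s * \<psi> u)"
      unfolding \<nu>_def using orth \<phi>(3) by (intro \<phi>(4)) (simp add: ip_linear_right[of _ 1, simplified])
    then show "0 \<le> 2 * s * (energy \<phi> \<psi> - \<nu> * ip \<phi> \<psi>) + s\<^sup>2 * (energy \<psi> \<psi> - \<nu> * ip \<psi> \<psi>)"
      unfolding energy_linear_right energy_linear_left ip_linear_left ip_linear_right
      using \<phi>(2) by (simp add: energy_commute[of \<psi> \<phi>] ip_commute[of \<psi> \<phi>] \<nu>_def power2_eq_square algebra_simps)
  qed
  then have "ip \<psi> \<psi> = 0" using ip_\<psi>[of \<psi>] by (simp add: ip_commute)
  then have "\<phi> \<in> eigenspace V E l \<nu>"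
    using \<phi>(1) by (auto simp: ip_self_eq_0_iff \<psi>_def eigenspace_def)
  moreover have "ip \<phi> (e j) = 0" if "j < k" for j
    using \<phi>(3)[OF that] by (simp add: ip_commute)
  ultimately have "eigensystem (Suc k) (e(k := \<phi>)) (\<mu>(k := \<nu>))"
    using sys \<phi> by (auto simp: eigensystem_def less_Suc_eq \<nu>_def)
  then show ?case by blast
qed

section \<open>Ordering of the eigenvalues and the Courant-Fischer bound\<close>

context
  fixes k e \<mu>
  assumes sys: "eigensystem k e \<mu>"
begin

lemma eigensystem_eigenfunction: "i < k \<Longrightarrow> e i \<in> eigenspace V E l (\<mu> i)"
  and eigensystem_ip: "i < k \<Longrightarrow> j < k \<Longrightarrow> ip (e i) (e j) = (if i = j then 1 else 0)"
  and eigensystem_rayleigh: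
    "i < k \<Longrightarrow> (\<And>j. j < i \<Longrightarrow> ip (e j) \<phi> = 0) \<Longrightarrow> \<mu> i * ip \<phi> \<phi> \<le> energy \<phi> \<phi>"
  using sys by (auto simp: eigensystem_def)

lemma eigensystem_energy: "i < k \<Longrightarrow> energy (e i) \<phi> = \<mu> i * ip (e i) \<phi>"
  by (rule energy_eigenfunction[OF eigensystem_eigenfunction])

text \<open>The later function \<open>e j\<close> is admissible in the minimisation that defines
  \<open>\<mu> i\<close>.\<close>

lemma eigensystem_mono:
  assumes "i \<le> j" "j < k"
  shows "\<mu> i \<le> \<mu> j"
proof -
  have "\<mu> i * ip (e j) (e j) \<le> energy (e j) (e j)"
    using assms by (intro eigensystem_rayleigh) (auto simp: eigensystem_ip)
  then show ?thesis using assms by (simp add: eigensystem_energy eigensystem_ip)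
qed

lemma eigensystem_nonneg:
  assumes "i < k"
  shows "0 \<le> \<mu> i"
  using energy_self_nonneg[of "e i"] assms by (simp add: eigensystem_energy eigensystem_ip)

lemma ip_eigensystem_combination:
  assumes "I \<subseteq> {..<k}" "j < k"
  shows "ip (\<lambda>u. \<Sum>i\<in>I. x i * e i u) (e j) = (if j \<in> I then x j else 0)"
proof -
  have "finite I" using assms finite_subset by blast
  have "ip (\<lambda>u. \<Sum>i\<in>I. x i * e i u) (e j) = (\<Sum>i\<in>I. if j = i then x i else 0)"
    unfolding ip_sum_left using assms by (intro sum.cong) (auto simp: eigensystem_ip subset_iff)
  then show ?thesis using \<open>finite I\<close> by simp
qed

text \<open>Courant--Fischer: among the combinations of the first \<open>j + 1\<close> eigenfunctions there is a nonzero
  one vanishing on \<open>W\<close>, and its Rayleigh quotient is at most \<open>\<mu> j\<close>.\<close>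

lemma eigensystem_ge:
  assumes "j < k" "W \<subseteq> V" "card W \<le> j"
    and bound: "\<And>\<phi>. (\<And>u. u \<in> W \<Longrightarrow> \<phi> u = 0) \<Longrightarrow> a * ip \<phi> \<phi> \<le> energy \<phi> \<phi>"
  shows "a \<le> \<mu> j"
proof -
  have "finite W" using assms finite_V finite_subset by blast
  then obtain x where x: "\<exists>i\<in>{..j}. x i \<noteq> 0" "\<forall>u\<in>W. (\<Sum>i\<le>j. e i u * x i) = 0"
    using underdetermined_system_solvable[of W "{..j}" e] assms by auto
  define \<phi> where "\<phi> u = (\<Sum>i\<le>j. x i * e i u)" for u
  have \<phi>_eq: "\<phi> = (\<lambda>u. \<Sum>i\<in>{..j}. x i * e i u)" by (auto simp: \<phi>_def)
  have coord: "ip (e i) \<phi> = x i" if "i \<le> j" for i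
    unfolding \<phi>_eq ip_commute[of "e i"] using that assms by (subst ip_eigensystem_combination) auto
  have "lap \<phi> u = (\<Sum>i\<le>j. x i * lap (e i) u)" for u
    unfolding \<phi>_def fujiwara_laplacian_def
    by (simp add: sum_distrib_left sum_subtractf[symmetric] algebra_simps)
       (rule sum.swap)
  then have lap_\<phi>: "lap \<phi> = (\<lambda>u. \<Sum>i\<in>{..j}. x i * lap (e i) u)" by auto
  have "energy \<phi> \<phi> = (\<Sum>i\<le>j. x i * energy (e i) \<phi>)"
    unfolding energy_eq_ip_lap lap_\<phi> ip_sum_left ..
  \<comment> \<open>Energy and norm are simultaneously diagonal in the eigenfunctions, so the
    quotient is a weighted mean of \<open>\<mu> 0, ..., \<mu> j\<close>.\<close>
  also have "\<dots> = (\<Sum>i\<le>j. \<mu> i * (x i)\<^sup>2)"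
    using assms by (intro sum.cong) (auto simp: eigensystem_energy coord power2_eq_square)
  also have "\<dots> \<le> (\<Sum>i\<le>j. \<mu> j * (x i)\<^sup>2)"
    using assms by (intro sum_mono mult_right_mono eigensystem_mono) auto
  finally have "energy \<phi> \<phi> \<le> \<mu> j * (\<Sum>i\<le>j. (x i)\<^sup>2)" by (simp add: sum_distrib_left)
  moreover have "ip \<phi> \<phi> = (\<Sum>i\<le>j. x i * ip (e i) \<phi>)"
    by (subst (1) \<phi>_eq) (rule ip_sum_left)
  then have norm: "ip \<phi> \<phi> = (\<Sum>i\<le>j. (x i)\<^sup>2)" by (simp add: coord power2_eq_square)
  moreover have "a * ip \<phi> \<phi> \<le> energy \<phi> \<phi>"
    using x by (intro bound) (simp add: \<phi>_def mult.commute)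
  ultimately have "a * (\<Sum>i\<le>j. (x i)\<^sup>2) \<le> \<mu> j * (\<Sum>i\<le>j. (x i)\<^sup>2)" by simp
  moreover obtain p where "p \<le> j" "x p \<noteq> 0" using x by auto
  then have "0 < (\<Sum>i\<le>j. (x i)\<^sup>2)" by (intro sum_pos2[of _ p]) auto
  ultimately show ?thesis by simp
qed

end

section \<open>Completeness and the spectrum with multiplicities\<close>

context
  fixes e \<mu>
  assumes sys: "eigensystem (card V) e \<mu>"
begin

text \<open>Otherwise \<open>\<phi>\<close> would extend the system to \<open>card V + 1\<close>
  pairwise orthogonal functions of nonzero norm, yet so many functions on \<open>V\<close> are
  linearly dependent there.\<close>

lemma orthogonal_to_eigensystem:
  assumes "\<And>i. i < card V \<Longrightarrow> ip \<phi> (e i) = 0" "u \<in> V"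
  shows "\<phi> u = 0"
proof (rule ccontr)
  assume "\<phi> u \<noteq> 0"
  then have "ip \<phi> \<phi> \<noteq> 0" using assms by (auto simp: ip_self_eq_0_iff)
  define n where "n = card V"
  define f where "f = e(n := \<phi>)"
  have f_orth: "ip (f i) (f j) = 0" if "i \<le> n" "j \<le> n" "i \<noteq> j" for i j
    using that assms eigensystem_ip[OF sys, of i j]
    by (auto simp: f_def n_def ip_commute[of "e i" \<phi>])
  have f_norm: "ip (f i) (f i) \<noteq> 0" if "i \<le> n" for i
    using that \<open>ip \<phi> \<phi> \<noteq> 0\<close> eigensystem_ip[OF sys, of i i] by (auto simp: f_def n_def)
  obtain x where x: "\<exists>i\<in>{..n}. x i \<noteq> 0" "\<forall>u\<in>V. (\<Sum>i\<in>{..n}. f i u * x i) = 0"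
    using underdetermined_system_solvable[of V "{..n}" f] finite_V by (auto simp: n_def)
  then obtain p where p: "p \<le> n" "x p \<noteq> 0" by auto
  have "0 = ip (\<lambda>u. \<Sum>i\<in>{..n}. x i * f i u) (f p)"
    unfolding ip_def using x by (simp add: mult.commute)
  also have "\<dots> = (\<Sum>i\<in>{..n}. if p = i then x p * ip (f p) (f p) else 0)"
    unfolding ip_sum_left using f_orth p by (intro sum.cong) auto
  finally show False using p f_norm[of p] by simp
qed

text \<open>Coefficients belonging to other eigenvalues vanish because
  \<open>energy \<phi> (e i)\<close> is both \<open>\<nu>\<close> and \<open>\<mu> i\<close> times
  \<open>ip \<phi> (e i)\<close>. What remains after subtraction is orthogonal to the whole
  system.\<close>

lemma eigenfunction_expansion:
  assumes "\<phi> \<in> eigenspace V E l \<nu>"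
  shows "\<phi> = (\<lambda>u. \<Sum>i\<in>{i. i < card V \<and> \<mu> i = \<nu>}. ip \<phi> (e i) * e i u)" (is "_ = ?\<psi>")
proof
  fix u
  let ?I = "{i. i < card V \<and> \<mu> i = \<nu>}"
  show "\<phi> u = ?\<psi> u"
  proof (cases "u \<in> V")
    case True
    have "1 * \<phi> u + (-1) * ?\<psi> u = 0"
    proof (rule orthogonal_to_eigensystem[OF _ True])
      fix i assume i: "i < card V"
      have "\<nu> * ip \<phi> (e i) = \<mu> i * ip \<phi> (e i)"
        using energy_eigenfunction[OF assms, of "e i"] eigensystem_energy[OF sys i, of \<phi>]
        by (simp add: energy_commute ip_commute)
      then have "\<mu> i \<noteq> \<nu> \<Longrightarrow> ip \<phi> (e i) = 0" by auto
      moreover have "ip ?\<psi> (e i) = (if i \<in> ?I then ip \<phi> (e i) else 0)"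
        using i by (intro ip_eigensystem_combination[OF sys]) auto
      ultimately show "ip (\<lambda>u. 1 * \<phi> u + (-1) * ?\<psi> u) (e i) = 0"
        unfolding ip_linear_left using i by auto
    qed
    then show ?thesis by simp
  next
    case False
    have "e i u = 0" if "i < card V" for i
      using eigensystem_eigenfunction[OF sys that] False by (auto simp: eigenspace_def)
    then show ?thesis using assms False by (auto simp: eigenspace_def)
  qed
qed

lemma dim_eigenspace:
  "real_fun.dim (eigenspace V E l \<nu>) = card {i. i < card V \<and> \<mu> i = \<nu>}"
proof -
  let ?I = "{i. i < card V \<and> \<mu> i = \<nu>}"
  \<comment> \<open>Needed to pass from the number of indices to the number of basis
    vectors.\<close>
  have inj: "inj_on e ?I"
    using eigensystem_ip[OF sys] by (intro inj_onI) (metis (no_types, lifting) mem_Collect_eq zero_neq_one)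
  have "real_fun.independent (e ` ?I)"
  proof (rule real_fun.independent_if_scalars_zero)
    fix f v assume sum0: "(\<Sum>v\<in>e ` ?I. (\<lambda>u. f v * v u)) = 0" and "v \<in> e ` ?I"
    then obtain j where j: "j \<in> ?I" "v = e j" by auto
    have "(\<Sum>i\<in>?I. f (e i) * e i u) = 0" for u
      using fun_cong[OF sum0, of u] by (simp add: sum.reindex[OF inj] sum_fun_apply)
    then have "0 = ip (\<lambda>u. \<Sum>i\<in>?I. f (e i) * e i u) (e j)" by (simp add: ip_def)
    also have "\<dots> = f (e j)"
      using j by (subst ip_eigensystem_combination[OF sys]) auto
    finally show "f v = 0" using j by simp
  qed auto
  moreover have "eigenspace V E l \<nu> \<subseteq> real_fun.span (e ` ?I)"
  proof
    fix \<phi> assume "\<phi> \<in> eigenspace V E l \<nu>"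
    from eigenfunction_expansion[OF this]
    have "\<phi> = (\<Sum>i\<in>?I. (\<lambda>u. ip \<phi> (e i) * e i u))"
      by (auto simp: fun_eq_iff sum_fun_apply)
    also have "\<dots> \<in> real_fun.span (e ` ?I)"
      by (intro real_fun.span_sum real_fun.span_scale real_fun.span_base) auto
    finally show "\<phi> \<in> real_fun.span (e ` ?I)" .
  qed
  moreover have "e ` ?I \<subseteq> eigenspace V E l \<nu>" using eigensystem_eigenfunction[OF sys] by auto
  ultimately show ?thesis by (intro real_fun.dim_unique) (auto simp: card_image inj)
qed

lemma eigenvalues_eq: "eigenvalues V E l = \<mu> ` {..<card V}"
proof (intro equalityI subsetI)
  fix \<nu> assume "\<nu> \<in> eigenvalues V E l"
  then obtain \<phi> where \<phi>: "\<phi> \<in> eigenspace V E l \<nu>" "\<phi> \<noteq> (\<lambda>_. 0)" by (auto simp: eigenvalues_def)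
  have "{i. i < card V \<and> \<mu> i = \<nu>} \<noteq> {}"
  proof
    assume empty: "{i. i < card V \<and> \<mu> i = \<nu>} = {}"
    from eigenfunction_expansion[OF \<phi>(1)] have "\<phi> = (\<lambda>_. 0)" unfolding empty by simp
    with \<phi> show False by simp
  qed
  then show "\<nu> \<in> \<mu> ` {..<card V}" by auto
next
  fix \<nu> assume "\<nu> \<in> \<mu> ` {..<card V}"
  then obtain i where i: "i < card V" "\<nu> = \<mu> i" by auto
  have "e i \<noteq> (\<lambda>_. 0)"
    using eigensystem_ip[OF sys i(1) i(1)] by (auto simp: ip_def)
  then show "\<nu> \<in> eigenvalues V E l"
    using eigensystem_eigenfunction[OF sys i(1)] i by (auto simp: eigenvalues_def)
qed

text \<open>Each value is repeated as often as it has indices, which is the dimension of its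
  eigenspace; the list on the right is increasing already, so sorting leaves it unchanged.\<close>

lemma spectrum_list_eq: "spectrum_list V E l = map \<mu> [0..<card V]"
proof -
  let ?M = "\<Sum>\<nu>\<in>\<mu> ` {..<card V}. replicate_mset (card {i. i < card V \<and> \<mu> i = \<nu>}) \<nu>"
  have "?M = mset (map \<mu> [0..<card V])"
  proof (rule multiset_eqI)
    fix x
    have "count ?M x = (\<Sum>\<nu>\<in>\<mu> ` {..<card V}. if x = \<nu> then card {i. i < card V \<and> \<mu> i = \<nu>} else 0)"
      by (auto simp: count_sum intro!: sum.cong)
    also have "\<dots> = card {i. i < card V \<and> \<mu> i = x}"
      by (auto simp: card_eq_0_iff)
    also have "\<dots> = count (mset (map \<mu> [0..<card V])) x"
      by (simp add: count_mset count_list_eq_length_filter length_filter_conv_card eq_commute[of x]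
          del: mset_map cong: conj_cong)
    finally show "count ?M x = count (mset (map \<mu> [0..<card V])) x" .
  qed
  then have "spectrum_list V E l = sort (map \<mu> [0..<card V])"
    unfolding spectrum_list_def dim_eigenspace eigenvalues_eq by (simp only: sorted_list_of_multiset_mset)
  also have "sorted (map \<mu> [0..<card V])"
    using eigensystem_mono[OF sys] by (auto simp: sorted_iff_nth_mono)
  then have "sort (map \<mu> [0..<card V]) = map \<mu> [0..<card V]" by (rule sorted_sort_id)
  finally show ?thesis .
qed

end

end


section \<open>Rescaling of the edge lengths\<close>

text \<open>The edge weights \<open>m1\<close> gain a factor \<open>c\<close> and the vertex weights
  lose one.\<close>

lemma fujiwara_laplacian_scale:
  assumes "0 < c"
  shows "fujiwara_laplacian V E (\<lambda>e. l e / c) \<phi> u = c\<^sup>2 * fujiwara_laplacian V E l \<phi> u"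
proof -
  have "m0 V E (\<lambda>e. l e / c) u = m0 V E l u / c" by (simp add: m0_def sum_divide_distrib)
  then show ?thesis
    by (simp add: fujiwara_laplacian_def m1_def sum_distrib_left power2_eq_square mult.assoc)
qed

lemma eigenvalues_scale:
  assumes "0 < c"
  shows "eigenvalues V E (\<lambda>e. l e / c) = (\<lambda>\<nu>. c\<^sup>2 * \<nu>) ` eigenvalues V E l"
proof -
  have space: "eigenspace V E (\<lambda>e. l e / c) \<nu> = eigenspace V E l (\<nu> / c\<^sup>2)" for \<nu>
    unfolding eigenspace_def fujiwara_laplacian_scale[OF assms] using assms
    by (auto simp: field_simps)
  have iff: "\<nu> \<in> eigenvalues V E (\<lambda>e. l e / c) \<longleftrightarrow> \<nu> / c\<^sup>2 \<in> eigenvalues V E l" for \<nu>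
    by (simp add: eigenvalues_def space)
  have "\<nu> \<in> eigenvalues V E (\<lambda>e. l e / c) \<longleftrightarrow> \<nu> \<in> (\<lambda>\<nu>. c\<^sup>2 * \<nu>) ` eigenvalues V E l" for \<nu>
    unfolding iff image_iff Bex_def using assms
    by (metis nonzero_mult_div_cancel_left nonzero_mult_div_cancel_right times_divide_eq_right
        power_not_zero less_irrefl)
  then show ?thesis by blast
qed

lemma lambda1_scale:
  assumes "0 < c" "finite {\<nu> \<in> eigenvalues V E l. 0 < \<nu>}" "{\<nu> \<in> eigenvalues V E l. 0 < \<nu>} \<noteq> {}"
  shows "lambda1 V E (\<lambda>e. l e / c) = c\<^sup>2 * lambda1 V E l"
proof -
  have "{\<nu> \<in> eigenvalues V E (\<lambda>e. l e / c). 0 < \<nu>} = (\<lambda>\<nu>. c\<^sup>2 * \<nu>) ` {\<nu> \<in> eigenvalues V E l. 0 < \<nu>}"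
    unfolding eigenvalues_scale[OF assms(1)] using assms(1) by (auto simp: zero_less_mult_iff)
  moreover have "mono (\<lambda>\<nu>. c\<^sup>2 * \<nu>)" by (intro monoI mult_left_mono) auto
  ultimately show ?thesis
    unfolding lambda1_def using assms by (simp add: mono_Min_commute[symmetric])
qed

section \<open>Energy estimates on the cycle\<close>

lemma neighbours_cycle:
  assumes "n \<ge> 3" "u \<in> cycle_verts n"
  shows "neighbours (cycle_verts n) (cycle_edges n) u =
    {if u = 1 then n else u - 1, if u = n then 1 else u + 1}"
  using assms unfolding neighbours_def cycle_edges_iff by (auto simp: cycle_verts_def)

locale thin_cycle =
  fixes n :: nat and t :: real
  assumes n: "n \<ge> 3" and t: "0 < t"
begin

sublocale weighted_graph "cycle_verts n" "cycle_edges n" "cycle_length n t"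
proof
  show "finite (cycle_verts n)" by (simp add: cycle_verts_def)
  show "0 < cycle_length n t e" for e using t by (simp add: cycle_length_def)
  show "0 < m0 (cycle_verts n) (cycle_edges n) (cycle_length n t) u" if "u \<in> cycle_verts n" for u
    unfolding m0_cycle[OF n that] using t by auto
qed

lemma card_cycle_verts: "card (cycle_verts n) = n"
  by (simp add: cycle_verts_def)

lemma cycle_verts_split: "cycle_verts n = {1..n - 2} \<union> {n - 1, n}"
  using n by (auto simp: cycle_verts_def)

text \<open>This is twice the total length of \<open>n - 1\<close> edges of length \<open>t\<close>
  and one edge of length 1.\<close>

lemma total_weight:
  "(\<Sum>u\<in>cycle_verts n. m0 (cycle_verts n) (cycle_edges n) (cycle_length n t) u) = 2 * (real n - 1) * t + 2"
proof -
  have "(\<Sum>u\<in>cycle_verts n. m0 (cycle_verts n) (cycle_edges n) (cycle_length n t) u) =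
      (\<Sum>u\<in>{1..n - 2} \<union> {n - 1, n}. if u \<le> n - 2 then 2 * t else 1 + t)"
    using m0_cycle[OF n] by (intro sum.cong) (auto simp: cycle_verts_split)
  also have "\<dots> = (\<Sum>u\<in>{1..n - 2}. 2 * t) + (\<Sum>u\<in>{n - 1, n}. 1 + t)"
    using n by (subst sum.union_disjoint) auto
  also have "\<dots> = real (n - 2) * (2 * t) + 2 * (1 + t)" using n by simp
  finally show ?thesis using n by (simp add: of_nat_diff algebra_simps)
qed

text \<open>The path \<open>n, 1, 2, ..., u\<close> avoids the edge of length 1, and along each of
  its fewer than \<open>n\<close> edges the function changes by at most
  \<open>sqrt (t * energy \<phi> \<phi>)\<close>.\<close>

lemma value_le_energy:
  assumes "\<phi> n = 0" "u \<in> cycle_verts n"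
  shows "(\<phi> u)\<^sup>2 \<le> (real n)\<^sup>2 * t * energy \<phi> \<phi>"
proof -
  define s where "s = sqrt (t * energy \<phi> \<phi>)"
  have E: "0 \<le> t * energy \<phi> \<phi>" using t energy_self_nonneg by simp
  have diff_le: "\<bar>\<phi> x - \<phi> y\<bar> \<le> s"
    if "x \<in> cycle_verts n" "y \<in> cycle_verts n" "x \<noteq> y" "{x, y} \<in> cycle_edges n" "{x, y} \<noteq> {n - 1, n}" for x y
    using edge_difference_le_energy[OF that(1-4), of \<phi>] that(5)
    by (simp add: s_def cycle_length_def real_le_rsqrt)
  \<comment> \<open>Vertex \<open>i\<close> is reached from \<open>n\<close> in exactly
    \<open>i\<close> steps, the first of which leads from \<open>n\<close> to 1.\<close>
  have "\<bar>\<phi> i\<bar> \<le> real i * s" if "1 \<le> i" "i \<le> n - 1" for i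
    using that
  proof (induction i rule: dec_induct)
    case base
    show ?case using diff_le[of n 1] n assms
      by (auto simp: cycle_edges_iff cycle_verts_def doubleton_eq_iff)
  next
    case (step i)
    have "\<bar>\<phi> i - \<phi> (Suc i)\<bar> \<le> s"
      using step n by (intro diff_le) (auto simp: cycle_edges_iff cycle_verts_def doubleton_eq_iff)
    moreover have "\<bar>\<phi> i\<bar> \<le> real i * s" using step by auto
    ultimately show ?case by (simp add: algebra_simps)
  qed
  moreover have "0 \<le> s" using E by (simp add: s_def)
  ultimately have "\<bar>\<phi> u\<bar> \<le> real u * s"
    using assms by (cases "u = n") (auto simp: cycle_verts_def)
  also have "\<dots> \<le> real n * s" using assms \<open>0 \<le> s\<close> by (auto simp: cycle_verts_def intro: mult_right_mono)
  finally have "\<bar>\<phi> u\<bar>\<^sup>2 \<le> (real n * s)\<^sup>2" by (intro power_mono) auto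
  then show ?thesis using E by (simp add: s_def power_mult_distrib mult.assoc)
qed

lemma ip_le_energy:
  assumes "\<phi> n = 0"
  shows "ip \<phi> \<phi> \<le> (2 * (real n - 1) * t + 2) * ((real n)\<^sup>2 * t * energy \<phi> \<phi>)"
proof -
  have "ip \<phi> \<phi> \<le> (\<Sum>u\<in>cycle_verts n. m0 (cycle_verts n) (cycle_edges n) (cycle_length n t) u *
      ((real n)\<^sup>2 * t * energy \<phi> \<phi>))"
    unfolding ip_def mult.assoc[of _ "\<phi> _"] power2_eq_square[of "\<phi> _", symmetric]
    using value_le_energy[of \<phi>, OF assms] weight_pos
    by (intro sum_mono mult_left_mono) (auto simp: less_imp_le)
  then show ?thesis unfolding sum_distrib_right[symmetric] total_weight .
qed

text \<open>Both heavy vertices drop out, and the weight \<open>2 * t\<close> of each remaining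
  vertex supplies a second factor \<open>t\<close>.\<close>

lemma ip_le_energy_off_edge:
  assumes "\<phi> n = 0" "\<phi> (n - 1) = 0"
  shows "ip \<phi> \<phi> \<le> 2 * real n ^ 3 * t\<^sup>2 * energy \<phi> \<phi>"
proof -
  have "ip \<phi> \<phi> \<le> (\<Sum>u\<in>cycle_verts n. 2 * t * ((real n)\<^sup>2 * t * energy \<phi> \<phi>))"
    unfolding ip_def
  proof (rule sum_mono)
    fix u assume u: "u \<in> cycle_verts n"
    show "m0 (cycle_verts n) (cycle_edges n) (cycle_length n t) u * \<phi> u * \<phi> u \<le>
        2 * t * ((real n)\<^sup>2 * t * energy \<phi> \<phi>)"
    proof (cases "u \<le> n - 2")
      case True
      then show ?thesis
        using value_le_energy[of \<phi>, OF assms(1) u] t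
        by (simp add: m0_cycle[OF n u] power2_eq_square mult.assoc)
    next
      case False
      then have "\<phi> u = 0" using assms u by (auto simp: cycle_verts_split)
      then show ?thesis using t energy_self_nonneg by simp
    qed
  qed
  then show ?thesis by (simp add: card_cycle_verts power2_eq_square power3_eq_cube mult_ac)
qed

lemma mu_1_denominator_pos: "0 < (2 * (real n - 1) * t + 2) * (real n)\<^sup>2 * t"
  using n t by (intro mult_pos_pos add_nonneg_pos mult_nonneg_nonneg) auto

text \<open>Only the two edges at \<open>n\<close> contribute: the one of length 1 and the one of
  length \<open>t\<close>.\<close>

lemma energy_indicator:
  "energy (\<lambda>u. if u = n then 1 else 0) (\<lambda>u. if u = n then 1 else 0) = 1 + 1 / t"
proof -
  let ?f = "\<lambda>u. if u = n then 1 else 0 :: real"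
  have nV: "n \<in> cycle_verts n" using n by (simp add: cycle_verts_def)
  have "energy ?f ?f = (\<Sum>u\<in>cycle_verts n. if u = n then
      m0 (cycle_verts n) (cycle_edges n) (cycle_length n t) n * lap ?f n else 0)"
    unfolding energy_eq_ip_lap ip_def by (intro sum.cong) auto
  also have "\<dots> = m0 (cycle_verts n) (cycle_edges n) (cycle_length n t) n * lap ?f n"
    using nV finite_V by simp
  also have "\<dots> = (\<Sum>v\<in>{n - 1, 1}. m1 (cycle_length n t) {n, v} * (?f n - ?f v))"
    unfolding weight_times_lap[OF nV] using neighbours_cycle[OF n nV] n by (intro sum.cong) auto
  also have "\<dots> = 1 + 1 / t"
    using n by (subst sum.insert) (auto simp: m1_def cycle_length_def doubleton_eq_iff)
  finally show ?thesis .
qed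

section \<open>Eigenvalue bounds on the cycle\<close>

context
  fixes e \<mu>
  assumes sys: "eigensystem (card (cycle_verts n)) e \<mu>"
begin

lemma mu_0: "\<mu> 0 = 0"
proof -
  have "\<mu> 0 * ip (\<lambda>_. 1) (\<lambda>_. 1) \<le> energy (\<lambda>_. 1) (\<lambda>_. 1)"
    using n by (intro eigensystem_rayleigh[OF sys]) (auto simp: card_cycle_verts)
  then have "\<mu> 0 * ip (\<lambda>_. 1) (\<lambda>_. 1) \<le> 0" by (simp add: energy_def)
  moreover have "0 < ip (\<lambda>_. 1) (\<lambda>_. 1)"
    using n ip_self_nonneg[of "\<lambda>_. 1"] ip_self_eq_0_iff[of "\<lambda>_. 1"] by (auto simp: cycle_verts_def)
  ultimately have "\<mu> 0 \<le> 0" by (simp add: mult_le_0_iff)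
  then show ?thesis
    using eigensystem_nonneg[OF sys, of 0] n by (simp add: card_cycle_verts)
qed

lemma mu_1_ge: "1 / ((2 * (real n - 1) * t + 2) * (real n)\<^sup>2 * t) \<le> \<mu> 1"
proof (rule eigensystem_ge[OF sys, of 1 "{n}"])
  fix \<phi> :: "nat \<Rightarrow> real" assume "\<And>u. u \<in> {n} \<Longrightarrow> \<phi> u = 0"
  then have "ip \<phi> \<phi> \<le> (2 * (real n - 1) * t + 2) * (real n)\<^sup>2 * t * energy \<phi> \<phi>"
    using ip_le_energy[of \<phi>] by (simp add: mult.assoc)
  moreover note mu_1_denominator_pos
  ultimately show "1 / ((2 * (real n - 1) * t + 2) * (real n)\<^sup>2 * t) * ip \<phi> \<phi> \<le> energy \<phi> \<phi>"
    by (simp add: pos_divide_le_eq mult.commute)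
qed (use n in \<open>auto simp: card_cycle_verts cycle_verts_def\<close>)

lemma mu_1_pos: "0 < \<mu> 1"
proof -
  have "0 < 1 / ((2 * (real n - 1) * t + 2) * (real n)\<^sup>2 * t)"
    using mu_1_denominator_pos by simp
  with mu_1_ge show ?thesis by linarith
qed

text \<open>For \<open>t < 1\<close> the total weight is at most \<open>2 * real n\<close>. The
  resulting constant agrees with the one for \<open>\<mu> 2\<close>, so that a single
  \<open>c\<close> serves both orders.\<close>

lemma mu_1_ge_inverse:
  assumes "t < 1"
  shows "1 / (2 * real n ^ 3) / t \<le> \<mu> 1"
proof -
  have "(2 * (real n - 1) * t + 2) \<le> 2 * (real n - 1) * 1 + 2"
    using n assms by (intro add_mono mult_left_mono) auto
  then have "(2 * (real n - 1) * t + 2) * (real n)\<^sup>2 * t \<le> 2 * real n * (real n)\<^sup>2 * t"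
    using t by (intro mult_right_mono) auto
  moreover note mu_1_denominator_pos
  ultimately have "1 / (2 * real n * (real n)\<^sup>2 * t) \<le> 1 / ((2 * (real n - 1) * t + 2) * (real n)\<^sup>2 * t)"
    by (intro divide_left_mono mult_pos_pos[of "2 * real n * (real n)\<^sup>2 * t"]) (use n t in auto)
  also note mu_1_ge
  finally show ?thesis by (simp add: power2_eq_square power3_eq_cube mult.assoc)
qed

text \<open>The test function is a combination of 1 and the indicator of \<open>n\<close>. Its
  energy has order \<open>1/t\<close>, while the two heavy vertices keep its norm bounded
  below.\<close>

lemma mu_1_le: "\<mu> 1 \<le> 2 / t"
proof -
  let ?f = "\<lambda>u. if u = n then 1 else 0 :: real"
  \<comment> \<open>These coefficients make the combination orthogonal to
    \<open>e 0\<close>.\<close>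
  define a b where "a = - ip (e 0) ?f" and "b = ip (e 0) (\<lambda>_. 1)"
  let ?\<phi> = "\<lambda>u. a * 1 + b * ?f u"
  have bound: "\<mu> 1 * ip \<phi> \<phi> \<le> energy \<phi> \<phi>" if "ip (e 0) \<phi> = 0" for \<phi>
    using n that by (intro eigensystem_rayleigh[OF sys]) (auto simp: card_cycle_verts)
  \<comment> \<open>If \<open>b\<close> were 0, the constant 1 would be admissible for
    \<open>\<mu> 1\<close> and have zero energy, contrary to \<open>\<mu> 1 > 0\<close>.\<close>
  have "b \<noteq> 0"
  proof
    assume "b = 0"
    then have "\<mu> 1 * ip (\<lambda>_. 1) (\<lambda>_. 1) \<le> energy (\<lambda>_. 1) (\<lambda>_. 1)"
      by (intro bound) (simp add: b_def)
    then have "\<mu> 1 * ip (\<lambda>_. 1) (\<lambda>_. 1) \<le> 0" by (simp add: energy_def)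
    then have "ip (\<lambda>_. 1) (\<lambda>_. 1) = 0"
      using mu_1_pos ip_self_nonneg[of "\<lambda>_. 1"] by (auto simp: mult_le_0_iff)
    then show False using n unfolding ip_self_eq_0_iff by (auto simp: cycle_verts_def)
  qed
  have "ip (e 0) ?\<phi> = 0" unfolding ip_linear_right by (simp add: a_def b_def)
  then have "\<mu> 1 * ip ?\<phi> ?\<phi> \<le> energy ?\<phi> ?\<phi>" by (rule bound)
  also have "energy ?\<phi> ?\<phi> = energy (\<lambda>u. b * ?f u + 0 * ?f u) (\<lambda>u. b * ?f u + 0 * ?f u)"
    using energy_shift[of a "\<lambda>u. b * ?f u"] by simp
  also have "\<dots> = b\<^sup>2 * (1 + 1 / t)"
    unfolding energy_linear_left energy_linear_right energy_indicator by (simp add: power2_eq_square)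
  finally have upper: "\<mu> 1 * ip ?\<phi> ?\<phi> \<le> b\<^sup>2 * (1 + 1 / t)" .
  \<comment> \<open>The test function equals \<open>a\<close> at \<open>n - 1\<close> and
    \<open>a + b\<close> at \<open>n\<close>; moreover \<open>a\<^sup>2 + (a + b)\<^sup>2 -
    b\<^sup>2 / 2 = (2 * a + b)\<^sup>2 / 2\<close>.\<close>
  have "(1 + t) * (b\<^sup>2 / 2) \<le> (1 + t) * (a\<^sup>2 + (a + b)\<^sup>2)"
    using t sum_squares_ge_zero[of "2 * a + b" 0]
    by (intro mult_left_mono) (auto simp: power2_eq_square algebra_simps)
  also have "\<dots> = (\<Sum>u\<in>{n - 1, n}. m0 (cycle_verts n) (cycle_edges n) (cycle_length n t) u * ?\<phi> u * ?\<phi> u)"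
  proof -
    have "n \<in> cycle_verts n" "n - 1 \<in> cycle_verts n" by (auto simp: cycle_verts_split)
    then have "m0 (cycle_verts n) (cycle_edges n) (cycle_length n t) n = 1 + t"
      "m0 (cycle_verts n) (cycle_edges n) (cycle_length n t) (n - 1) = 1 + t"
      using n by (auto simp: m0_cycle)
    moreover have "n - 1 \<noteq> n" using n by simp
    ultimately show ?thesis by (simp add: power2_eq_square algebra_simps)
  qed
  also have "\<dots> \<le> ip ?\<phi> ?\<phi>"
    unfolding ip_def using finite_V weight_pos
    by (intro sum_mono2) (auto simp: cycle_verts_split mult.assoc less_imp_le)
  finally have "\<mu> 1 * ((1 + t) * (b\<^sup>2 / 2)) \<le> \<mu> 1 * ip ?\<phi> ?\<phi>"
    using mu_1_pos by (intro mult_left_mono) auto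
  also note upper
  also have "b\<^sup>2 * (1 + 1 / t) = 2 / t * ((1 + t) * (b\<^sup>2 / 2))" using t by (simp add: field_simps)
  finally show ?thesis
    by (rule mult_right_le_imp_le) (use t \<open>b \<noteq> 0\<close> in simp)
qed

lemma mu_2_ge: "1 / (2 * real n ^ 3) / t\<^sup>2 \<le> \<mu> 2"
proof (rule eigensystem_ge[OF sys, of 2 "{n, n - 1}"])
  fix \<phi> :: "nat \<Rightarrow> real" assume "\<And>u. u \<in> {n, n - 1} \<Longrightarrow> \<phi> u = 0"
  then have "ip \<phi> \<phi> \<le> 2 * real n ^ 3 * t\<^sup>2 * energy \<phi> \<phi>" by (intro ip_le_energy_off_edge) auto
  moreover have "0 < 2 * real n ^ 3 * t\<^sup>2" using n t by simp
  ultimately have "1 / (2 * real n ^ 3 * t\<^sup>2) * ip \<phi> \<phi> \<le> energy \<phi> \<phi>"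
    by (simp add: pos_divide_le_eq mult.commute)
  then show "1 / (2 * real n ^ 3) / t\<^sup>2 * ip \<phi> \<phi> \<le> energy \<phi> \<phi>" by simp
qed (use n in \<open>auto simp: card_cycle_verts cycle_verts_def\<close>)

text \<open>Every vertex has two neighbours, edge weights at most \<open>1 / t\<close>, and vertex
  weight at least \<open>2 * t\<close>; the last two use \<open>t < 1\<close>.\<close>

lemma mu_le:
  assumes "t < 1" "k < n"
  shows "\<mu> k \<le> 2 / t\<^sup>2"
proof -
  have "\<mu> k \<le> 2 * (1 / t\<^sup>2)"
  proof (rule eigenvalue_le)
    show "\<mu> k \<in> eigenvalues (cycle_verts n) (cycle_edges n) (cycle_length n t)"
      using assms by (auto simp: eigenvalues_eq[OF sys] card_cycle_verts)
    show "0 \<le> \<mu> k" using assms eigensystem_nonneg[OF sys] by (simp add: card_cycle_verts)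
    fix u assume u: "u \<in> cycle_verts n"
    have "(\<Sum>v\<in>neighbours (cycle_verts n) (cycle_edges n) u. m1 (cycle_length n t) {u, v}) \<le>
        of_nat (card (neighbours (cycle_verts n) (cycle_edges n) u)) * (1 / t)"
      using t assms by (intro sum_bounded_above) (auto simp: m1_def cycle_length_def)
    also have "\<dots> \<le> 2 * (1 / t)"
      using t unfolding neighbours_cycle[OF n u] by (intro mult_right_mono) (auto simp: card_insert_if)
    also have "\<dots> = 1 / t\<^sup>2 * (2 * t)" using t by (simp add: power2_eq_square)
    also have "\<dots> \<le> 1 / t\<^sup>2 * m0 (cycle_verts n) (cycle_edges n) (cycle_length n t) u"
      using assms by (intro mult_left_mono) (auto simp: m0_cycle[OF n u])
    finally show "(\<Sum>v\<in>neighbours (cycle_verts n) (cycle_edges n) u. m1 (cycle_length n t) {u, v}) \<le>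
        1 / t\<^sup>2 * m0 (cycle_verts n) (cycle_edges n) (cycle_length n t) u" .
  qed
  then show ?thesis by simp
qed

lemma lambda1_eq: "lambda1 (cycle_verts n) (cycle_edges n) (cycle_length n t) = \<mu> 1"
  unfolding lambda1_def eigenvalues_eq[OF sys] card_cycle_verts
proof (rule Min_eqI)
  fix \<nu> assume "\<nu> \<in> {\<nu> \<in> \<mu> ` {..<n}. 0 < \<nu>}"
  then obtain i where "i < n" "\<nu> = \<mu> i" "0 < \<mu> i" by auto
  moreover have "1 \<le> i" using \<open>0 < \<mu> i\<close> mu_0 by (cases i) auto
  ultimately show "\<mu> 1 \<le> \<nu>" using eigensystem_mono[OF sys, of 1 i] by (simp add: card_cycle_verts)
qed (use n mu_1_pos in auto)

end

lemma obtain_cycle_eigensystem: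
  obtains e \<mu> where "eigensystem (card (cycle_verts n)) e \<mu>" "cycle_spectrum n t = map \<mu> [0..<n]"
proof -
  obtain e \<mu> where sys: "eigensystem (card (cycle_verts n)) e \<mu>"
    using eigensystem_exists[of "card (cycle_verts n)"] by auto
  then show thesis
    using that spectrum_list_eq[OF sys] by (simp add: cycle_spectrum_def card_cycle_verts)
qed

lemma cycle_spectrum_basic:
  "length (cycle_spectrum n t) = n \<and> cycle_spectrum n t ! 0 = 0 \<and> 0 < cycle_spectrum n t ! 1 \<and>
   cycle_spectrum n t ! 1 = lambda1 (cycle_verts n) (cycle_edges n) (cycle_length n t)"
proof -
  obtain e \<mu> where sys: "eigensystem (card (cycle_verts n)) e \<mu>" "cycle_spectrum n t = map \<mu> [0..<n]"
    by (rule obtain_cycle_eigensystem)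
  then show ?thesis
    using n mu_0[OF sys(1)] mu_1_pos[OF sys(1)] lambda1_eq[OF sys(1)] by simp
qed

lemma cycle_spectrum_bounds:
  assumes "t < 1"
  shows "1 / (2 * real n ^ 3) / t \<le> cycle_spectrum n t ! 1" "cycle_spectrum n t ! 1 \<le> 2 / t"
    "k \<in> {2..n - 1} \<Longrightarrow> 1 / (2 * real n ^ 3) / t\<^sup>2 \<le> cycle_spectrum n t ! k"
    "k \<in> {2..n - 1} \<Longrightarrow> cycle_spectrum n t ! k \<le> 2 / t\<^sup>2"
proof -
  obtain e \<mu> where sys: "eigensystem (card (cycle_verts n)) e \<mu>" "cycle_spectrum n t = map \<mu> [0..<n]"
    by (rule obtain_cycle_eigensystem)
  have nth: "cycle_spectrum n t ! i = \<mu> i" if "i < n" for i using that sys by simp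
  show "1 / (2 * real n ^ 3) / t \<le> cycle_spectrum n t ! 1" "cycle_spectrum n t ! 1 \<le> 2 / t"
    using n mu_1_ge_inverse[OF sys(1) assms] mu_1_le[OF sys(1)] nth[of 1] by simp_all
  assume k: "k \<in> {2..n - 1}"
  then have "k < n" using n by auto
  show "cycle_spectrum n t ! k \<le> 2 / t\<^sup>2"
    unfolding nth[OF \<open>k < n\<close>] by (rule mu_le[OF sys(1) assms \<open>k < n\<close>])
  have "\<mu> 2 \<le> \<mu> k"
    using k \<open>k < n\<close> by (intro eigensystem_mono[OF sys(1)]) (auto simp: card_cycle_verts)
  with mu_2_ge[OF sys(1)] show "1 / (2 * real n ^ 3) / t\<^sup>2 \<le> cycle_spectrum n t ! k"
    unfolding nth[OF \<open>k < n\<close>] by linarith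
qed

text \<open>Division by the total weight \<open>M\<close> multiplies \<lambda>1 by
  \<open>M\<^sup>2 \<ge> 1\<close>, so the lower bound of order \<open>1/t\<close> survives.\<close>

lemma normalised_length_exists:
  assumes "t < 1"
  shows "\<exists>l. (\<forall>e\<in>cycle_edges n. 0 < l e) \<and> (\<Sum>u\<in>cycle_verts n. m0 (cycle_verts n) (cycle_edges n) l u) = 1 \<and>
    1 / (2 * real n ^ 3) / t \<le> lambda1 (cycle_verts n) (cycle_edges n) l"
proof -
  define M where "M = 2 * (real n - 1) * t + 2"
  define l where "l e = cycle_length n t e / M" for e
  have l_eq: "l = (\<lambda>e. cycle_length n t e / M)" by (auto simp: l_def)
  have "1 \<le> M" using n t by (simp add: M_def add_increasing)
  obtain e \<mu> where sys: "eigensystem (card (cycle_verts n)) e \<mu>"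
    by (rule obtain_cycle_eigensystem)
  have "lambda1 (cycle_verts n) (cycle_edges n) l =
      M\<^sup>2 * lambda1 (cycle_verts n) (cycle_edges n) (cycle_length n t)"
    unfolding l_eq using n mu_1_pos[OF sys] \<open>1 \<le> M\<close>
    by (intro lambda1_scale) (auto simp: eigenvalues_eq[OF sys] card_cycle_verts)
  also have "\<dots> \<ge> 1 * \<mu> 1"
    unfolding lambda1_eq[OF sys] using \<open>1 \<le> M\<close> mu_1_pos[OF sys] by (intro mult_right_mono) auto
  finally have "1 / (2 * real n ^ 3) / t \<le> lambda1 (cycle_verts n) (cycle_edges n) l"
    using mu_1_ge_inverse[OF sys assms] by linarith
  moreover have "m0 (cycle_verts n) (cycle_edges n) l u =
      m0 (cycle_verts n) (cycle_edges n) (cycle_length n t) u / M" for u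
    by (simp add: m0_def l_def sum_divide_distrib)
  then have "(\<Sum>u\<in>cycle_verts n. m0 (cycle_verts n) (cycle_edges n) l u) = 1"
    using total_weight \<open>1 \<le> M\<close> by (simp add: sum_divide_distrib[symmetric] M_def)
  moreover have "\<forall>e\<in>cycle_edges n. 0 < l e" using length_pos \<open>1 \<le> M\<close> by (auto simp: l_def)
  ultimately show ?thesis by blast
qed

end

section \<open>The infinite supremum and the asymptotic orders\<close>

lemma Lambda1_cycle:
  assumes "n \<ge> 3"
  shows "Lambda1 (cycle_verts n) (cycle_edges n) = \<infinity>"
  unfolding Lambda1_def
proof (rule SUP_PInfty)
  fix N :: nat
  define c where "c = 1 / (2 * real n ^ 3)"
  have "1 \<le> real n ^ 3" using assms by (intro one_le_power) auto
  then have "c < 1" unfolding c_def using assms by (subst pos_divide_less_eq) (simp, linarith)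
  have "0 < c" using assms by (simp add: c_def)
  note c = \<open>0 < c\<close> \<open>c < 1\<close>
  \<comment> \<open>Chosen so that \<open>c / t = real N + 1\<close>; \<open>c < 1\<close> ensures
    \<open>t < 1\<close>.\<close>
  define t where "t = c / (real N + 1)"
  have "0 < t" using c by (simp add: t_def)
  have "t < 1" using c by (simp add: t_def field_simps)
  interpret thin_cycle n t using assms \<open>0 < t\<close> by unfold_locales
  have "real N \<le> c / t" using c by (simp add: t_def)
  with normalised_length_exists[OF \<open>t < 1\<close>]
  show "\<exists>l\<in>{l. (\<forall>e\<in>cycle_edges n. 0 < l e) \<and>
      (\<Sum>u\<in>cycle_verts n. m0 (cycle_verts n) (cycle_edges n) l u) = 1}.
      ereal (real N) \<le> ereal (lambda1 (cycle_verts n) (cycle_edges n) l)"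
    by (fastforce simp: c_def)
qed

theorem theorem2p1:
  fixes n :: nat
  assumes "n \<ge> 3"
  shows "(\<forall>t>0. length (cycle_spectrum n t) = n \<and>
             cycle_spectrum n t ! 0 = 0 \<and>
             0 < cycle_spectrum n t ! 1 \<and>
             cycle_spectrum n t ! 1 = lambda1 (cycle_verts n) (cycle_edges n) (cycle_length n t)) \<and>
         (\<exists>c C. 0 < c \<and> c < C \<and>
           (\<forall>\<^sub>F t in at_right 0.
              (c / t \<le> cycle_spectrum n t ! 1 \<and> cycle_spectrum n t ! 1 \<le> C / t) \<and>
              (\<forall>k\<in>{2..n - 1}. c / t\<^sup>2 \<le> cycle_spectrum n t ! k \<and>
                               cycle_spectrum n t ! k \<le> C / t\<^sup>2))) \<and>
         Lambda1 (cycle_verts n) (cycle_edges n) = \<infinity>"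
proof (intro conjI[OF _ conjI] exI)
  have cyc: "thin_cycle n t" if "0 < t" for t using assms that by unfold_locales
  show "\<forall>t>0. length (cycle_spectrum n t) = n \<and> cycle_spectrum n t ! 0 = 0 \<and>
      0 < cycle_spectrum n t ! 1 \<and>
      cycle_spectrum n t ! 1 = lambda1 (cycle_verts n) (cycle_edges n) (cycle_length n t)"
    using thin_cycle.cycle_spectrum_basic[OF cyc] by blast
  show "Lambda1 (cycle_verts n) (cycle_edges n) = \<infinity>" using Lambda1_cycle[OF assms] .
  \<comment> \<open>The constants are fixed here as \<open>c = 1 / (2 * real n ^ 3)\<close> and
    below as \<open>C = 2\<close>; they depend on \<open>n\<close> at most and serve all
    eigenvalues.\<close>
  show "0 < 1 / (2 * real n ^ 3)" using assms by simp
  have "1 \<le> real n ^ 3" using assms by (intro one_le_power) auto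
  then show "1 / (2 * real n ^ 3) < 2" using assms by (subst pos_divide_less_eq) (simp, linarith)
  have "\<forall>\<^sub>F t in at_right 0. t \<in> {0<..<1::real}"
    by (rule eventually_at_right_real) simp
  then show "\<forall>\<^sub>F t in at_right 0.
      (1 / (2 * real n ^ 3) / t \<le> cycle_spectrum n t ! 1 \<and> cycle_spectrum n t ! 1 \<le> 2 / t) \<and>
      (\<forall>k\<in>{2..n - 1}. 1 / (2 * real n ^ 3) / t\<^sup>2 \<le> cycle_spectrum n t ! k \<and>
        cycle_spectrum n t ! k \<le> 2 / t\<^sup>2)"
  proof (rule eventually_mono)
    fix t :: real assume "t \<in> {0<..<1}"
    then have "0 < t" "t < 1" by auto
    from thin_cycle.cycle_spectrum_bounds[OF cyc[OF \<open>0 < t\<close>] \<open>t < 1\<close>]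
    show "(1 / (2 * real n ^ 3) / t \<le> cycle_spectrum n t ! 1 \<and> cycle_spectrum n t ! 1 \<le> 2 / t) \<and>
      (\<forall>k\<in>{2..n - 1}. 1 / (2 * real n ^ 3) / t\<^sup>2 \<le> cycle_spectrum n t ! k \<and>
        cycle_spectrum n t ! k \<le> 2 / t\<^sup>2)" by blast
  qed
qed

end
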